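(* Let $Q$ be the sequence-form polytope of a tree-form sequential decision process with set of decision points $\mathcal J$, action sets $A_j$, and set of sequences $\Sigma$, and let $M_Q=\max_{x\in Q}\|x\|_1$. The dilatable global entropy $\tilde\varphi: Q\to\mathbb R_{\ge0}$, \[ \tilde\varphi(x) = w_\varnothing x_\varnothing\log x_\varnothing + \sum_{j\in\mathcal J}\sum_{a\in A_j} w_{ja}\,x_{ja}\log x_{ja} + \sum_{j\in\mathcal J}\gamma_j\, x_{p_j}\log|A_j|, \] (with the weights $\gamma,w$ defined in the context) is strongly convex with modulus $1/M_Q$ with respect to the $\ell_1$ norm on $\operatorname{relint}Q$.
   Context: Tree-form sequential decision process: a finite set $\mathcal J$ of decision points; each $j\in\mathcal J$ has a finite nonempty set of actions $A_j$. The set of sequences is $\Sigma=\{\varnothing\}\cup\{ja: j\in\mathcal J, a\in A_j\}$, where $\varnothing$ is a special element called the empty sequence. For each pair $ja$, $\mathcal C_{ja}\subset\mathcal J$ is the (possibly empty) set of next potential decision points after taking action $a$ at $j$; the decision points form a tree (forest), so $\mathcal C_{ja}\cap\mathcal C_{j'a'}=\emptyset$ whenever $ja\neq j'a'$. The parent sequence $p_j\in\Sigma$ of $j$ is the last sequence encountered on the path from the root to $j$ (so $p_{j'}=ja$ iff $j'\in\mathcal C_{ja}$), and $p_j=\varnothing$ if there is none; $\mathcal C_\varnothing=\{j\in\mathcal J: p_j=\varnothing\}$. The sequence-form polytope $Q$ is the set of all $x\in\mathbb R^{|\Sigma|}_{\ge0}$ with $x_\varnothing=1$ and $\sum_{a\in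 A_j}x_{ja}=x_{p_j}$ for all $j\in\mathcal J$. Weights, defined recursively: \[ \gamma_\varnothing = 1+\sum_{j\in\mathcal C_\varnothing}\gamma_j,\qquad \gamma_j = 1+\max_{a\in A_j}\Big\{\sum_{j'\in\mathcal C_{ja}}\gamma_{j'}\Big\}\ (j\in\mathcal J), \] \[ w_\varnothing = \gamma_\varnothing-\sum_{j\in\mathcal C_\varnothing}\gamma_j,\qquad w_{ja} = \gamma_j-\sum_{j'\in\mathcal C_{ja}}\gamma_{j'}\ (j\in\mathcal J,\ a\in A_j). \] Convention: $0\log 0=0$. A function $d$ is strongly convex with modulus $\mu$ on $\operatorname{relint}\mathcal X$ with respect to $\|\cdot\|$ if $(\nabla d(x)-\nabla d(x'))^\top(x-x')\ge\mu\|x-x'\|^2$ for all $x,x'\in\operatorname{relint}\mathcal X$. *)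

theory Defs
  imports "HOL-Analysis.Analysis"
begin

definition l1_norm :: "real ^ 'n \<Rightarrow> real" where
  "l1_norm x = (\<Sum>i\<in>UNIV. \<bar>x $ i\<bar>)"

text \<open>
  The gradient is the one in the whole ambient space, so this is meant for functions whose
  defining expression is differentiable in a neighbourhood of every point of \<open>S\<close>, even when \<open>S\<close>
  has empty interior. Differentiability on \<open>S\<close> is part of the property.
\<close>

definition strongly_convex_wrt ::
  "('v::euclidean_space \<Rightarrow> real) \<Rightarrow> real \<Rightarrow> 'v set \<Rightarrow> ('v \<Rightarrow> real) \<Rightarrow> bool" where
  "strongly_convex_wrt N \<mu> S d \<longleftrightarrow>
    (\<exists>g. (\<forall>x\<in>S. GDERIV d x :> g x) \<and>
         (\<forall>x\<in>S. \<forall>x'\<in>S. (g x - g x') \<bullet> (x - x') \<ge> \<mu> * (N (x - x'))\<^sup>2))"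

text \<open>
  The empty sequence is \<open>None\<close>, and the sequence \<open>ja\<close> is \<open>Some (j, a)\<close>. The type classes make
  \<open>J\<close> and all action sets finite; values of \<open>A\<close> and \<open>C\<close> outside \<open>J\<close>, respectively outside the
  legal pairs \<open>(j, a)\<close>, are irrelevant. Acyclicity together with disjointness of the sets \<open>C j a\<close>
  says that the decision points form a forest.
\<close>

locale tree_form_decision_process =
  fixes J :: "'j::finite set"
    and A :: "'j \<Rightarrow> 'a::finite set"
    and C :: "'j \<Rightarrow> 'a \<Rightarrow> 'j set"
  assumes actions_nonempty: "j \<in> J \<Longrightarrow> A j \<noteq> {}"
    and next_subset: "j \<in> J \<Longrightarrow> a \<in> A j \<Longrightarrow> C j a \<subseteq> J"
    and next_disjoint: "j \<in> J \<Longrightarrow> a \<in> A j \<Longrightarrow> j' \<in> J \<Longrightarrow> a' \<in> A j' \<Longrightarrow>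
          (j, a) \<noteq> (j', a') \<Longrightarrow> C j a \<inter> C j' a' = {}"
    and next_acyclic: "acyclic {(j', j). j \<in> J \<and> (\<exists>a\<in>A j. j' \<in> C j a)}"
begin

definition seqs :: "('j \<times> 'a) option set" where
  "seqs = {None} \<union> {Some (j, a) | j a. j \<in> J \<and> a \<in> A j}"

definition parent :: "'j \<Rightarrow> ('j \<times> 'a) option" where
  "parent j' = (if \<exists>j\<in>J. \<exists>a\<in>A j. j' \<in> C j a
     then Some (THE (j, a). j \<in> J \<and> a \<in> A j \<and> j' \<in> C j a) else None)"

lemma parent_eq_Some_iff:
  assumes "j \<in> J" "a \<in> A j"
  shows "parent j' = Some (j, a) \<longleftrightarrow> j' \<in> C j a"
proof -
  have THE_eq: "(THE (j, a). j \<in> J \<and> a \<in> A j \<and> j' \<in> C j a) = (k, b)"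
    if "k \<in> J" "b \<in> A k" "j' \<in> C k b" for k b
    by (rule the_equality) (use that next_disjoint in blast)+
  show ?thesis
  proof
    assume L: "parent j' = Some (j, a)"
    then obtain k b where kb: "k \<in> J" "b \<in> A k" "j' \<in> C k b"
      by (auto simp: parent_def split: if_splits)
    then have "parent j' = Some (k, b)"
      unfolding parent_def using THE_eq[OF kb] by auto
    with L kb show "j' \<in> C j a" by simp
  next
    assume "j' \<in> C j a"
    then show "parent j' = Some (j, a)"
      unfolding parent_def using THE_eq[OF assms] assms by auto
  qed
qed

definition roots :: "'j set" where
  "roots = {j \<in> J. parent j = None}"

text \<open>
  \<open>\<real>\<^sup>\<Sigma>\<close> is represented inside \<open>real ^ (('j \<times> 'a) option)\<close> as the subspace of vectors
  vanishing off \<open>seqs\<close>.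
\<close>

definition sequence_form_polytope :: "(real ^ (('j \<times> 'a) option)) set" where
  "sequence_form_polytope =
    {x. (\<forall>s. s \<notin> seqs \<longrightarrow> x $ s = 0) \<and> (\<forall>s\<in>seqs. x $ s \<ge> 0) \<and> x $ None = 1 \<and>
        (\<forall>j\<in>J. (\<Sum>a\<in>A j. x $ Some (j, a)) = x $ parent j)}"

definition max_l1_norm :: real where
  "max_l1_norm = (GREATEST m. \<exists>x\<in>sequence_form_polytope. m = l1_norm x)"

function \<gamma> :: "'j \<Rightarrow> real" where
  "\<gamma> j = (if j \<in> J then 1 + Max ((\<lambda>a. \<Sum>j'\<in>C j a. \<gamma> j') ` A j) else 0)"
  by auto
termination
proof (relation "{(j', j). j \<in> J \<and> (\<exists>a\<in>A j. j' \<in> C j a)}")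
  show "wf {(j', j). j \<in> J \<and> (\<exists>a\<in>A j. j' \<in> C j a)}"
    by (rule finite_acyclic_wf) (simp_all add: next_acyclic)
qed auto

declare \<gamma>.simps [simp del]

definition \<gamma>_empty :: real where
  "\<gamma>_empty = 1 + (\<Sum>j\<in>roots. \<gamma> j)"

definition w_empty :: real where
  "w_empty = \<gamma>_empty - (\<Sum>j\<in>roots. \<gamma> j)"

definition w :: "'j \<Rightarrow> 'a \<Rightarrow> real" where
  "w j a = \<gamma> j - (\<Sum>j'\<in>C j a. \<gamma> j')"

text \<open>The convention \<open>0 log 0 = 0\<close> holds automatically, since \<open>0 * ln 0 = 0\<close>.\<close>

definition dilatable_global_entropy :: "real ^ (('j \<times> 'a) option) \<Rightarrow> real" where
  "dilatable_global_entropy x =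
     w_empty * (x $ None * ln (x $ None))
     + (\<Sum>j\<in>J. \<Sum>a\<in>A j. w j a * (x $ Some (j, a) * ln (x $ Some (j, a))))
     + (\<Sum>j\<in>J. \<gamma> j * x $ parent j * ln (real (card (A j))))"

end

end

theory Submission imports Defs begin

text \<open>
  For sequences of the tree the weights satisfy \<open>w \<ge> 1\<close>, so the Bregman-type expression
  \<open>(\<nabla>\<phi> x - \<nabla>\<phi> x') \<bullet> (x - x')\<close> dominates \<open>\<Sum>\<^sub>s (ln x\<^sub>s - ln x'\<^sub>s) (x\<^sub>s - x'\<^sub>s)\<close>. The logarithmic mean is at
  most the arithmetic mean, hence each summand is at least \<open>(x\<^sub>s - x'\<^sub>s)\<^sup>2 / m\<^sub>s\<close> with \<open>m\<close> the
  midpoint of \<open>x\<close> and \<open>x'\<close>; Cauchy--Schwarz and \<open>\<Sum>\<^sub>s m\<^sub>s \<le> M\<^sub>Q\<close>, valid because \<open>m\<close> lies in \<open>Q\<close>,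
  give the modulus. Nonnegativity follows by telescoping the weights along the tree, which turns
  \<open>\<phi>\<close> into a combination with coefficients \<open>\<gamma> j\<close> of the local quantities
  \<open>\<Sum>\<^sub>a x\<^sub>j\<^sub>a ln x\<^sub>j\<^sub>a - x\<^sub>p ln (x\<^sub>p / |A j|)\<close>, \<open>p\<close> being the parent of \<open>j\<close>; these are nonnegative by
  the log-sum inequality.
\<close>

section \<open>Scalar and finite-sum inequalities for the logarithm\<close>

lemma ln_ge_arith_mean:
  fixes t :: real
  assumes "t \<ge> 1"
  shows "2 * (t - 1) / (t + 1) \<le> ln t"
proof -
  let ?f = "\<lambda>t::real. ln t - 2 * (t - 1) / (t + 1)"
  have "?f 1 \<le> ?f t"
  proof (rule DERIV_nonneg_imp_nondecreasing[OF assms])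
    fix u :: real assume u: "1 \<le> u" "u \<le> t"
    have "(?f has_real_derivative 1 / u - 4 / (u + 1)\<^sup>2) (at u)"
      using u by (auto intro!: derivative_eq_intros simp: field_simps power2_eq_square)
    \<comment> \<open>Over the common denominator the numerator is
      \<open>(u + 1)\<^sup>2 - 4 * u\<close>, a perfect square; this gives monotonicity from the
      base point 1, where \<open>?f\<close> vanishes.\<close>
    moreover have "1 / u - 4 / (u + 1)\<^sup>2 = (u - 1)\<^sup>2 / (u * (u + 1)\<^sup>2)"
      using u by (simp add: divide_simps) (simp add: power2_eq_square algebra_simps)
    ultimately show "\<exists>y. (?f has_real_derivative y) (at u) \<and> y \<ge> 0"
      using u by (intro exI[of _ "1 / u - 4 / (u + 1)\<^sup>2"]) auto
  qed
  then show ?thesis by simp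
qed

text \<open>Both sides are symmetric in \<open>a\<close> and \<open>b\<close>, so
  \<open>a \<le> b\<close> may be assumed; then the previous bound applies at the ratio
  \<open>b / a\<close>.\<close>

lemma ln_diff_mult_diff_ge:
  fixes a b :: real
  assumes "a > 0" "b > 0"
  shows "(a - b)\<^sup>2 / ((a + b) / 2) \<le> (ln a - ln b) * (a - b)"
  using assms
proof (induction a b rule: linorder_wlog)
  case (le a b)
  have "2 * (b / a - 1) / (b / a + 1) \<le> ln (b / a)"
    using le by (intro ln_ge_arith_mean) simp
  moreover have "2 * (b / a - 1) / (b / a + 1) = (b - a) / ((a + b) / 2)"
    using le by (simp add: divide_simps) (simp add: algebra_simps)
  ultimately have "(b - a) / ((a + b) / 2) \<le> ln b - ln a"
    using le by (simp add: ln_div)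
  from mult_right_mono[OF this, of "b - a"] le show ?case
    by (simp add: power2_eq_square algebra_simps)
next
  case (sym a b)
  then show ?case by (simp add: power2_commute add.commute algebra_simps)
qed

lemma sum_weighted_ln_diff_ge:
  fixes a b w :: "'i \<Rightarrow> real"
  assumes pos: "\<And>i. i \<in> I \<Longrightarrow> a i > 0" "\<And>i. i \<in> I \<Longrightarrow> b i > 0"
    and w: "\<And>i. i \<in> I \<Longrightarrow> w i \<ge> 1"
    and M: "M > 0" "(\<Sum>i\<in>I. (a i + b i) / 2) \<le> M"
  shows "(\<Sum>i\<in>I. \<bar>a i - b i\<bar>)\<^sup>2 / M \<le> (\<Sum>i\<in>I. w i * ((ln (a i) - ln (b i)) * (a i - b i)))"
proof -
  define T where "T = (\<Sum>i\<in>I. \<bar>a i - b i\<bar>)"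
  \<comment> \<open>Cauchy--Schwarz in linearised form: \<open>d\<^sup>2 / m \<ge> 2 t d - t\<^sup>2 m\<close>, with \<open>t\<close> optimal for the sum\<close>
  define t where "t = T / M"
  have "2 * t * \<bar>a i - b i\<bar> - t\<^sup>2 * ((a i + b i) / 2) \<le> w i * ((ln (a i) - ln (b i)) * (a i - b i))"
    if i: "i \<in> I" for i
  proof -
    define m where "m = (a i + b i) / 2"
    define d where "d = \<bar>a i - b i\<bar>"
    have m: "m > 0" using pos[OF i] by (simp add: m_def)
    have "0 \<le> (d - t * m)\<^sup>2 / m" using m by simp
    also have "\<dots> = d\<^sup>2 / m - (2 * t * d - t\<^sup>2 * m)"
      using m by (simp add: power2_eq_square field_simps)
    finally have "2 * t * d - t\<^sup>2 * m \<le> d\<^sup>2 / m" by simp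
    also have "\<dots> \<le> (ln (a i) - ln (b i)) * (a i - b i)"
      using ln_diff_mult_diff_ge[OF pos[OF i]] by (simp add: m_def d_def)
    finally have 1: "2 * t * d - t\<^sup>2 * m \<le> (ln (a i) - ln (b i)) * (a i - b i)" .
    \<comment> \<open>The unweighted summand must be known to be nonnegative before its weight can
      be lowered to 1.\<close>
    have "0 \<le> (a i - b i)\<^sup>2 / ((a i + b i) / 2)" using pos[OF i] by simp
    also have "\<dots> \<le> (ln (a i) - ln (b i)) * (a i - b i)"
      by (rule ln_diff_mult_diff_ge[OF pos[OF i]])
    finally have "1 * ((ln (a i) - ln (b i)) * (a i - b i)) \<le> w i * ((ln (a i) - ln (b i)) * (a i - b i))"
      using w[OF i] by (intro mult_right_mono)
    with 1 show ?thesis by (simp add: m_def d_def)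
  qed
  then have "(\<Sum>i\<in>I. 2 * t * \<bar>a i - b i\<bar> - t\<^sup>2 * ((a i + b i) / 2))
      \<le> (\<Sum>i\<in>I. w i * ((ln (a i) - ln (b i)) * (a i - b i)))"
    by (rule sum_mono)
  also have "(\<Sum>i\<in>I. 2 * t * \<bar>a i - b i\<bar> - t\<^sup>2 * ((a i + b i) / 2))
      = 2 * t * T - t\<^sup>2 * (\<Sum>i\<in>I. (a i + b i) / 2)"
    unfolding T_def sum_subtractf sum_distrib_left by simp
  finally have *: "2 * t * T - t\<^sup>2 * (\<Sum>i\<in>I. (a i + b i) / 2)
      \<le> (\<Sum>i\<in>I. w i * ((ln (a i) - ln (b i)) * (a i - b i)))" .
  have "T\<^sup>2 / M = 2 * t * T - t\<^sup>2 * M"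
    using M(1) by (simp add: t_def power2_eq_square field_simps)
  also have "\<dots> \<le> 2 * t * T - t\<^sup>2 * (\<Sum>i\<in>I. (a i + b i) / 2)"
    using M(2) by (simp add: mult_left_mono)
  finally show ?thesis using * by (simp add: T_def)
qed

text \<open>Each entry is compared with the mean \<open>m\<close>: applying ln y \<le> y - 1 at
  \<open>y = m / x i\<close> bounds \<open>x i * ln (x i)\<close> below by
  \<open>x i * ln m + (x i - m)\<close>, and the corrections \<open>x i - m\<close> sum to zero.
  Zero entries are allowed.\<close>

lemma log_sum_ge:
  fixes x :: "'i \<Rightarrow> real"
  assumes "finite I" "I \<noteq> {}" and nonneg: "\<And>i. i \<in> I \<Longrightarrow> x i \<ge> 0"
  shows "sum x I * ln (sum x I) - sum x I * ln (real (card I)) \<le> (\<Sum>i\<in>I. x i * ln (x i))"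
proof (cases "sum x I = 0")
  case True
  then show ?thesis using assms by (simp add: sum_nonneg_eq_0_iff)
next
  case False
  then have S: "sum x I > 0" using sum_nonneg[of I x] nonneg by fastforce
  have n: "real (card I) > 0" using assms by (simp add: card_gt_0_iff)
  define m where "m = sum x I / card I"
  have m: "m > 0" using S n by (simp add: m_def)
  have "x i * ln m + (x i - m) \<le> x i * ln (x i)" if "i \<in> I" for i
  proof (cases "x i = 0")
    case True
    then show ?thesis using m by simp
  next
    case False
    then have x: "x i > 0" using nonneg[OF that] by simp
    have "ln (m / x i) \<le> m / x i - 1" using x m by (intro ln_le_minus_one) simp
    then have "x i * (ln m - ln (x i)) \<le> x i * (m / x i - 1)"
      using x m by (intro mult_left_mono) (simp_all add: ln_div)
    then show ?thesis using x by (simp add: algebra_simps)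
  qed
  then have "(\<Sum>i\<in>I. x i * ln m + (x i - m)) \<le> (\<Sum>i\<in>I. x i * ln (x i))"
    by (rule sum_mono)
  moreover have "(\<Sum>i\<in>I. x i * ln m + (x i - m)) = sum x I * ln m"
    using n by (simp add: sum.distrib sum_subtractf sum_distrib_right m_def)
  ultimately show ?thesis using S n by (simp add: m_def ln_div algebra_simps)
qed

text \<open>The segment from \<open>u\<close> to \<open>x\<close> can be prolonged slightly beyond
  \<open>x\<close> inside \<open>S\<close>. If \<open>f x\<close> were not positive,
  \<open>f\<close> would be negative on the prolongation.\<close>

lemma rel_interior_linear_pos:
  fixes f :: "'v::euclidean_space \<Rightarrow> real"
  assumes "convex S" "x \<in> rel_interior S" "u \<in> S" "linear f" "f u > 0"
    and nonneg: "\<And>y. y \<in> S \<Longrightarrow> f y \<ge> 0"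
  shows "f x > 0"
proof -
  obtain m where "m > 1" and m: "\<And>e. e > 1 \<Longrightarrow> e \<le> m \<Longrightarrow> (1 - e) *\<^sub>R u + e *\<^sub>R x \<in> S"
    using convex_rel_interior_if[OF assms(1,2)] assms(3) hull_inc by metis
  from nonneg[OF m[of m]] \<open>m > 1\<close> have "0 \<le> (1 - m) * f u + m * f x"
    by (simp add: linear_add[OF assms(4)] linear_scale[OF assms(4)])
  moreover have "(m - 1) * f u > 0" using \<open>m > 1\<close> assms(5) by simp
  ultimately have "m * f x > 0" by (simp add: algebra_simps)
  then show ?thesis using \<open>m > 1\<close> by (simp add: zero_less_mult_iff)
qed

section \<open>Sums over the tree and the weights\<close>

context tree_form_decision_process
begin

lemma sum_seqs:
  fixes f :: "('j \<times> 'a) option \<Rightarrow> real"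
  shows "sum f seqs = f None + (\<Sum>j\<in>J. \<Sum>a\<in>A j. f (Some (j, a)))"
proof -
  have "seqs = insert None (Some ` Sigma J A)" by (auto simp: seqs_def)
  then have "sum f seqs = f None + sum f (Some ` Sigma J A)" by simp
  also have "sum f (Some ` Sigma J A) = (\<Sum>(j, a)\<in>Sigma J A. f (Some (j, a)))"
    by (subst sum.reindex) (auto simp: inj_on_def intro!: sum.cong)
  also have "\<dots> = (\<Sum>j\<in>J. \<Sum>a\<in>A j. f (Some (j, a)))"
    by (simp add: sum.Sigma)
  finally show ?thesis .
qed

lemma parent_in_seqs: "parent j \<in> seqs"
proof (cases "\<exists>k\<in>J. \<exists>a\<in>A k. j \<in> C k a")
  case True
  then obtain k a where "k \<in> J" "a \<in> A k" "j \<in> C k a" by blast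
  then show ?thesis using parent_eq_Some_iff[of k a j] by (auto simp: seqs_def)
next
  case False
  then show ?thesis by (simp add: parent_def seqs_def)
qed

text \<open>Decision points are grouped by their parent sequence: the group of the empty sequence is
  \<open>roots\<close>, that of a legal pair \<open>(j, a)\<close> is \<open>C j a\<close>.\<close>

lemma sum_children:
  fixes f :: "('j \<times> 'a) option \<Rightarrow> real"
  shows "(\<Sum>j\<in>J. \<gamma> j * f (parent j))
    = (\<Sum>j\<in>roots. \<gamma> j) * f None + (\<Sum>j\<in>J. \<Sum>a\<in>A j. (\<Sum>j'\<in>C j a. \<gamma> j') * f (Some (j, a)))"
proof -
  have C: "{j' \<in> J. parent j' = Some (j, a)} = C j a" if "j \<in> J" "a \<in> A j" for j a
    using parent_eq_Some_iff[OF that] next_subset[OF that] by auto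
  have "(\<Sum>j\<in>J. \<gamma> j * f (parent j)) = (\<Sum>s\<in>seqs. \<Sum>j\<in>{j \<in> J. parent j = s}. \<gamma> j * f (parent j))"
    by (rule sum.group[symmetric]) (use parent_in_seqs in auto)
  also have "\<dots> = (\<Sum>s\<in>seqs. (\<Sum>j\<in>{j \<in> J. parent j = s}. \<gamma> j) * f s)"
    by (simp add: sum_distrib_right)
  also have "\<dots> = (\<Sum>j\<in>roots. \<gamma> j) * f None
      + (\<Sum>j\<in>J. \<Sum>a\<in>A j. (\<Sum>j'\<in>C j a. \<gamma> j') * f (Some (j, a)))"
    by (simp add: sum_seqs C roots_def cong: sum.cong)
  finally show ?thesis .
qed

text \<open>Summation by parts on the tree: the child weights subtracted in \<open>w j a\<close> are
  charged to the children, where they multiply the value of \<open>f\<close> at the parent. Only the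
  roots leave a boundary term.\<close>

lemma sum_w:
  fixes f :: "('j \<times> 'a) option \<Rightarrow> real"
  shows "(\<Sum>j\<in>J. \<Sum>a\<in>A j. w j a * f (Some (j, a)))
    = (\<Sum>j\<in>J. \<gamma> j * ((\<Sum>a\<in>A j. f (Some (j, a))) - f (parent j))) + (\<Sum>j\<in>roots. \<gamma> j) * f None"
proof -
  have "(\<Sum>j\<in>J. \<Sum>a\<in>A j. w j a * f (Some (j, a)))
    = (\<Sum>j\<in>J. \<gamma> j * (\<Sum>a\<in>A j. f (Some (j, a))))
      - (\<Sum>j\<in>J. \<Sum>a\<in>A j. (\<Sum>j'\<in>C j a. \<gamma> j') * f (Some (j, a)))"
    by (simp add: w_def left_diff_distrib sum_subtractf sum_distrib_left)
  then show ?thesis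
    using sum_children[of f] by (simp add: right_diff_distrib sum_subtractf)
qed

lemma w_ge_1:
  assumes "j \<in> J" "a \<in> A j"
  shows "w j a \<ge> 1"
proof -
  have "(\<Sum>j'\<in>C j a. \<gamma> j') \<le> Max ((\<lambda>a. \<Sum>j'\<in>C j a. \<gamma> j') ` A j)"
    using assms by (intro Max_ge) auto
  then show ?thesis using assms by (simp add: w_def \<gamma>.simps[of j])
qed

text \<open>Allows the local log-sum inequalities to be scaled by \<open>\<gamma> j\<close>. Any
  available action \<open>a\<close> writes \<open>\<gamma> j\<close> as \<open>w j a\<close> plus
  the weights of the children, which are nonnegative by induction.\<close>

lemma \<gamma>_nonneg: "\<gamma> j \<ge> 0"
proof (induction j rule: \<gamma>.induct)
  case (1 j)
  show ?case
  proof (cases "j \<in> J")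
    case True
    then obtain a where a: "a \<in> A j" using actions_nonempty by blast
    have "0 \<le> (\<Sum>j'\<in>C j a. \<gamma> j')" using 1 True a by (intro sum_nonneg) blast
    then show ?thesis using w_ge_1[OF True a] by (simp add: w_def)
  qed (simp add: \<gamma>.simps)
qed

lemma w_empty_eq: "w_empty = 1"
  by (simp add: w_empty_def \<gamma>_empty_def)

section \<open>Geometry of the sequence-form polytope\<close>

lemma polytopeD:
  assumes "x \<in> sequence_form_polytope"
  shows "s \<notin> seqs \<Longrightarrow> x $ s = 0" "x $ s \<ge> 0" "x $ None = 1"
    "j \<in> J \<Longrightarrow> (\<Sum>a\<in>A j. x $ Some (j, a)) = x $ parent j"
  using assms by (cases "s \<in> seqs"; auto simp: sequence_form_polytope_def)+

lemma convex_polytope: "convex sequence_form_polytope"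
  unfolding sequence_form_polytope_def convex_def
  by (auto simp: sum.distrib simp flip: sum_distrib_left)

lemma l1_norm_eq:
  assumes "\<And>s. s \<notin> seqs \<Longrightarrow> x $ s = 0"
  shows "l1_norm x = \<bar>x $ None\<bar> + (\<Sum>j\<in>J. \<Sum>a\<in>A j. \<bar>x $ Some (j, a)\<bar>)"
proof -
  have "l1_norm x = (\<Sum>s\<in>seqs. \<bar>x $ s\<bar>)"
    unfolding l1_norm_def using assms by (intro sum.mono_neutral_right) auto
  then show ?thesis by (simp add: sum_seqs)
qed

text \<open>Provides boundedness of the polytope. Replacing the coefficients 1 by
  \<open>w j a\<close> only increases the sum, and the flow constraints then annihilate every
  bracket of \<open>sum_w\<close>, leaving the constant root term.\<close>

lemma l1_norm_le_\<gamma>_empty: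
  assumes "x \<in> sequence_form_polytope"
  shows "l1_norm x \<le> \<gamma>_empty"
proof -
  have "l1_norm x = 1 + (\<Sum>j\<in>J. \<Sum>a\<in>A j. x $ Some (j, a))"
    using polytopeD[OF assms] by (simp add: l1_norm_eq)
  also have "\<dots> \<le> 1 + (\<Sum>j\<in>J. \<Sum>a\<in>A j. w j a * x $ Some (j, a))"
    using mult_right_mono[OF w_ge_1 polytopeD(2)[OF assms]]
    by (intro add_left_mono sum_mono) simp
  also have "\<dots> = \<gamma>_empty"
    using sum_w[of "\<lambda>s. x $ s"] polytopeD(3,4)[OF assms] by (simp add: \<gamma>_empty_def)
  finally show ?thesis .
qed

lemma compact_polytope: "compact sequence_form_polytope"
  unfolding compact_eq_bounded_closed
proof
  show "bounded sequence_form_polytope"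
    unfolding bounded_iff
    using order_trans[OF norm_le_l1_cart l1_norm_le_\<gamma>_empty[unfolded l1_norm_def]] by blast
  show "closed sequence_form_polytope"
    unfolding sequence_form_polytope_def Ball_def
    by (intro closed_Collect_conj closed_Collect_all closed_Collect_imp closed_Collect_eq
        closed_Collect_le continuous_intros) auto
qed

text \<open>Such a point shows that no sequence coordinate vanishes identically on the polytope;
  hence all of them are positive on the relative interior, where the logarithms have to be
  differentiated.\<close>

lemma positive_point_exists:
  obtains u where "u \<in> sequence_form_polytope" "\<And>s. s \<in> seqs \<Longrightarrow> u $ s > 0"
proof -
  define R where "R = {(j', j). j \<in> J \<and> (\<exists>a\<in>A j. j' \<in> C j a)}"
  \<comment> \<open>the uniform strategy: \<open>R\<^sup>* `` {j}\<close> is the path from \<open>j\<close> up to its root\<close>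
  define v where "v j = (\<Prod>k\<in>R\<^sup>* `` {j}. 1 / real (card (A k)))" for j
  define u :: "real ^ ('j \<times> 'a) option" where
    "u = (\<chi> s. case s of None \<Rightarrow> 1 | Some (j, a) \<Rightarrow> if j \<in> J \<and> a \<in> A j then v j else 0)"
  have in_J: "k \<in> J" if "(j, k) \<in> R\<^sup>*" "j \<in> J" for j k
    using that by (induction rule: rtrancl_induct) (auto simp: R_def)
  have card_pos: "card (A j) > 0" if "j \<in> J" for j
    using actions_nonempty[OF that] by (simp add: card_gt_0_iff)
  have v_pos: "v j > 0" if "j \<in> J" for j
    unfolding v_def using in_J that card_pos by (intro prod_pos) auto
  have flow: "card (A j) * v j = u $ parent j" if j: "j \<in> J" for j
  proof (cases "parent j")
    case None
    then have "R\<^sup>* `` {j} = {j}"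
      by (auto simp: R_def parent_def elim: converse_rtranclE split: if_splits)
    then show ?thesis using actions_nonempty[OF j] None by (simp add: v_def u_def)
  next
    case (Some ka)
    then obtain k a where ka: "k \<in> J" "a \<in> A k" "parent j = Some (k, a)"
      using parent_in_seqs[of j] by (auto simp: seqs_def)
    then have "j \<in> C k a" using parent_eq_Some_iff by blast
    \<comment> \<open>The parent is unique, so the only upward step from \<open>j\<close> leads to
      \<open>k\<close>, and the path of \<open>j\<close> is \<open>j\<close> followed by the path of
      \<open>k\<close>.\<close>
    have R_iff: "(j, k') \<in> R \<longleftrightarrow> k' = k" for k'
    proof -
      have "(j, k') \<in> R \<longleftrightarrow> k' \<in> J \<and> (\<exists>b\<in>A k'. parent j = Some (k', b))"
        using parent_eq_Some_iff by (auto simp: R_def)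
      then show ?thesis using ka by auto
    qed
    have "R\<^sup>* `` {j} = insert j (R\<^sup>* `` {k})"
      using R_iff by (auto elim: converse_rtranclE intro: converse_rtrancl_into_rtrancl)
    \<comment> \<open>Acyclicity keeps \<open>j\<close> off the path of its parent, so
      \<open>v j\<close> has exactly one factor more than \<open>v k\<close>.\<close>
    moreover have "j \<notin> R\<^sup>* `` {k}"
    proof
      assume "j \<in> R\<^sup>* `` {k}"
      then have "(j, j) \<in> R\<^sup>+" using R_iff by (auto intro: rtrancl_into_trancl2)
      then show False using next_acyclic by (auto simp: R_def acyclic_def)
    qed
    ultimately have "v j = 1 / card (A j) * v k" by (simp add: v_def)
    then show ?thesis using actions_nonempty[OF j] ka by (simp add: u_def)
  qed
  have "u $ s > 0" if "s \<in> seqs" for s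
    using that v_pos by (auto simp: seqs_def u_def)
  moreover have "u \<in> sequence_form_polytope"
    unfolding sequence_form_polytope_def
  proof (intro CollectI conjI allI impI ballI)
    show "u $ s = 0" if "s \<notin> seqs" for s
      using that by (auto simp: u_def seqs_def split: option.split)
    show "0 \<le> u $ s" if "s \<in> seqs" for s
      using calculation[OF that] by simp
    show "u $ None = 1" by (simp add: u_def)
    show "(\<Sum>a\<in>A j. u $ Some (j, a)) = u $ parent j" if "j \<in> J" for j
      using that flow[OF that, symmetric] by (simp add: u_def)
  qed
  ultimately show thesis using that by blast
qed

lemma rel_interior_polytope_pos:
  assumes "x \<in> rel_interior sequence_form_polytope" "s \<in> seqs"
  shows "x $ s > 0"
proof -
  obtain u where u: "u \<in> sequence_form_polytope" "u $ s > 0"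
    using positive_point_exists assms(2) by metis
  show ?thesis
    by (rule rel_interior_linear_pos[OF convex_polytope assms(1) u(1), of "\<lambda>y. y $ s"])
      (use u polytopeD in \<open>auto intro: bounded_linear.linear bounded_linear_vec_nth\<close>)
qed

text \<open>The \<open>GREATEST\<close> in \<open>max_l1_norm\<close> denotes a maximum only if one
  is attained, which follows from compactness and continuity.\<close>

lemma l1_norm_le_max:
  assumes "x \<in> sequence_form_polytope"
  shows "l1_norm x \<le> max_l1_norm"
proof -
  have "continuous_on sequence_form_polytope l1_norm"
    unfolding l1_norm_def by (intro continuous_intros)
  then obtain y where y: "y \<in> sequence_form_polytope"
      "\<And>z. z \<in> sequence_form_polytope \<Longrightarrow> l1_norm z \<le> l1_norm y"
    using continuous_attains_sup[OF compact_polytope] assms by blast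
  then have "max_l1_norm = l1_norm y"
    unfolding max_l1_norm_def by (intro Greatest_equality) auto
  with y(2)[OF assms] show ?thesis by simp
qed

section \<open>Nonnegativity, gradient and strong convexity of the entropy\<close>

lemma entropy_nonneg:
  assumes x: "x \<in> sequence_form_polytope"
  shows "0 \<le> dilatable_global_entropy x"
proof -
  let ?h = "\<lambda>s. x $ s * ln (x $ s)"
  \<comment> \<open>The terms at the empty sequence vanish, since its coordinate is 1 and ln 1 =
    0.\<close>
  have "dilatable_global_entropy x
      = (\<Sum>j\<in>J. \<gamma> j * ((\<Sum>a\<in>A j. ?h (Some (j, a))) - ?h (parent j)
          + x $ parent j * ln (real (card (A j)))))"
    using sum_w[of ?h] polytopeD(3)[OF x]
    by (simp add: dilatable_global_entropy_def sum.distrib distrib_left mult.assoc)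
  also have "\<dots> \<ge> 0"
  proof (intro sum_nonneg mult_nonneg_nonneg \<gamma>_nonneg)
    fix j assume j: "j \<in> J"
    show "0 \<le> (\<Sum>a\<in>A j. ?h (Some (j, a))) - ?h (parent j) + x $ parent j * ln (real (card (A j)))"
      using log_sum_ge[of "A j" "\<lambda>a. x $ Some (j, a)"] actions_nonempty[OF j]
        polytopeD(2)[OF x] polytopeD(4)[OF x j] by simp
  qed
  finally show ?thesis .
qed

text \<open>Gradient in the ambient space, with \<open>w_empty\<close> already replaced by 1. The
  last sum does not depend on \<open>x\<close> and so cancels in differences of gradients.\<close>

definition entropy_grad :: "real ^ (('j \<times> 'a) option) \<Rightarrow> real ^ (('j \<times> 'a) option)" where
  "entropy_grad x = (ln (x $ None) + 1) *\<^sub>R axis None 1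
     + (\<Sum>j\<in>J. \<Sum>a\<in>A j. (w j a * (ln (x $ Some (j, a)) + 1)) *\<^sub>R axis (Some (j, a)) 1)
     + (\<Sum>j\<in>J. (\<gamma> j * ln (real (card (A j)))) *\<^sub>R axis (parent j) 1)"

lemma inner_entropy_grad:
  "h \<bullet> entropy_grad x = (ln (x $ None) + 1) * h $ None
     + (\<Sum>j\<in>J. \<Sum>a\<in>A j. w j a * (ln (x $ Some (j, a)) + 1) * h $ Some (j, a))
     + (\<Sum>j\<in>J. \<gamma> j * ln (real (card (A j))) * h $ parent j)"
  by (simp add: entropy_grad_def inner_add_right inner_sum_right inner_axis)

lemma GDERIV_entropy:
  assumes pos: "\<And>s. s \<in> seqs \<Longrightarrow> x $ s > 0"
  shows "GDERIV dilatable_global_entropy x :> entropy_grad x"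
proof -
  have [simp]: "x $ None > 0" using pos by (simp add: seqs_def)
  have h: "((\<lambda>x. x $ s * ln (x $ s)) has_derivative (\<lambda>h. (ln (x $ s) + 1) * h $ s)) (at x)"
    if "s \<in> seqs" for s
    using pos[OF that]
    by (auto intro!: derivative_eq_intros bounded_linear.has_derivative[OF bounded_linear_vec_nth]
        simp: field_simps)
  have l: "((\<lambda>x. \<gamma> j * x $ s * c) has_derivative (\<lambda>h. \<gamma> j * c * h $ s)) (at x)" for j s c
    by (auto intro!: derivative_eq_intros bounded_linear.has_derivative[OF bounded_linear_vec_nth])
  have "(dilatable_global_entropy has_derivative (\<lambda>h. (ln (x $ None) + 1) * h $ None
     + (\<Sum>j\<in>J. \<Sum>a\<in>A j. w j a * ((ln (x $ Some (j, a)) + 1) * h $ Some (j, a)))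
     + (\<Sum>j\<in>J. \<gamma> j * ln (real (card (A j))) * h $ parent j))) (at x)"
    unfolding dilatable_global_entropy_def[abs_def] w_empty_eq mult_1
    by (intro has_derivative_add has_derivative_sum has_derivative_mult_right h l)
      (auto simp: seqs_def)
  then show ?thesis
    unfolding gderiv_def by (simp add: inner_entropy_grad mult.assoc)
qed

lemma entropy_grad_strongly_monotone:
  assumes x: "x \<in> sequence_form_polytope" "\<And>s. s \<in> seqs \<Longrightarrow> x $ s > 0"
    and y: "y \<in> sequence_form_polytope" "\<And>s. s \<in> seqs \<Longrightarrow> y $ s > 0"
  shows "(l1_norm (x - y))\<^sup>2 / max_l1_norm \<le> (entropy_grad x - entropy_grad y) \<bullet> (x - y)"
proof -
  let ?I = "Sigma J A" and ?M = max_l1_norm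
  define m where "m = (1/2) *\<^sub>R x + (1/2) *\<^sub>R y"
  have m: "m \<in> sequence_form_polytope"
    unfolding m_def using x y by (intro convexD[OF convex_polytope]) auto
  have "l1_norm m = 1 + (\<Sum>j\<in>J. \<Sum>a\<in>A j. m $ Some (j, a))"
    using polytopeD[OF m] by (simp add: l1_norm_eq)
  also have "(\<Sum>j\<in>J. \<Sum>a\<in>A j. m $ Some (j, a))
      = (\<Sum>i\<in>?I. (x $ Some i + y $ Some i) / 2)"
    by (simp add: sum.Sigma m_def add_divide_distrib split_def)
  finally have M: "1 + (\<Sum>i\<in>?I. (x $ Some i + y $ Some i) / 2) \<le> ?M"
    using l1_norm_le_max[OF m] by simp
  have I: "i \<in> ?I \<Longrightarrow> Some i \<in> seqs" for i by (auto simp: seqs_def)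
  have "0 \<le> (\<Sum>i\<in>?I. (x $ Some i + y $ Some i) / 2)"
    using polytopeD(2)[OF x(1)] polytopeD(2)[OF y(1)] by (intro sum_nonneg) simp
  \<comment> \<open>The summand 1 from the empty sequence makes \<open>max_l1_norm\<close> positive
    even if \<open>J\<close> is empty.\<close>
  with M have "?M > 0" by simp
  have "l1_norm (x - y) = (\<Sum>i\<in>?I. \<bar>x $ Some i - y $ Some i\<bar>)"
    using polytopeD(1,3)[OF x(1)] polytopeD(1,3)[OF y(1)]
    by (simp add: l1_norm_eq sum.Sigma split_def)
  moreover have "(entropy_grad x - entropy_grad y) \<bullet> (x - y)
      = (\<Sum>i\<in>?I. case_prod w i * ((ln (x $ Some i) - ln (y $ Some i)) * (x $ Some i - y $ Some i)))"
  proof -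
    have "(entropy_grad x - entropy_grad y) \<bullet> (x - y)
        = (x - y) \<bullet> entropy_grad x - (x - y) \<bullet> entropy_grad y"
      by (simp add: inner_commute inner_diff_right)
    \<comment> \<open>Only the logarithms weighted by \<open>w\<close> survive: \<open>x\<close> and
      \<open>y\<close> agree at the empty sequence, and the constants in the gradient
      cancel.\<close>
    also have "\<dots> = (\<Sum>j\<in>J. \<Sum>a\<in>A j. w j a *
        ((ln (x $ Some (j, a)) - ln (y $ Some (j, a))) * (x $ Some (j, a) - y $ Some (j, a))))"
      unfolding inner_entropy_grad
      using polytopeD(3)[OF x(1)] polytopeD(3)[OF y(1)]
      by (simp flip: sum_subtractf add: algebra_simps)
    finally show ?thesis by (simp add: sum.Sigma split_def)
  qed
  moreover have "(\<Sum>i\<in>?I. \<bar>x $ Some i - y $ Some i\<bar>)\<^sup>2 / ?M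
      \<le> (\<Sum>i\<in>?I. case_prod w i * ((ln (x $ Some i) - ln (y $ Some i)) * (x $ Some i - y $ Some i)))"
    using M \<open>?M > 0\<close> x(2) y(2) I w_ge_1
    by (intro sum_weighted_ln_diff_ge) auto
  ultimately show ?thesis by simp
qed

lemma entropy_strongly_convex:
  "strongly_convex_wrt l1_norm (1 / max_l1_norm) (rel_interior sequence_form_polytope)
     dilatable_global_entropy"
  unfolding strongly_convex_wrt_def
proof (intro exI[of _ entropy_grad] conjI ballI)
  fix x assume x: "x \<in> rel_interior sequence_form_polytope"
  show "GDERIV dilatable_global_entropy x :> entropy_grad x"
    by (intro GDERIV_entropy rel_interior_polytope_pos x)
  fix y assume y: "y \<in> rel_interior sequence_form_polytope"
  show "1 / max_l1_norm * (l1_norm (x - y))\<^sup>2 \<le> (entropy_grad x - entropy_grad y) \<bullet> (x - y)"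
    using entropy_grad_strongly_monotone[of x y] rel_interior_polytope_pos[OF x]
      rel_interior_polytope_pos[OF y] rel_interior_subset[of sequence_form_polytope] x y
    by auto
qed

end

theorem theorem5:
  fixes J :: "'j::finite set"
    and A :: "'j \<Rightarrow> 'a::finite set"
    and C :: "'j \<Rightarrow> 'a \<Rightarrow> 'j set"
  assumes "tree_form_decision_process J A C"
  defines "Q \<equiv> tree_form_decision_process.sequence_form_polytope J A C"
    and "M\<^sub>Q \<equiv> tree_form_decision_process.max_l1_norm J A C"
    and "\<phi> \<equiv> tree_form_decision_process.dilatable_global_entropy J A C"
  shows "(\<forall>x\<in>Q. 0 \<le> \<phi> x) \<and> strongly_convex_wrt l1_norm (1 / M\<^sub>Q) (rel_interior Q) \<phi>"
proof -
  interpret tree_form_decision_process J A C by (rule assms(1))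
  show ?thesis
    unfolding Q_def M\<^sub>Q_def \<phi>_def using entropy_nonneg entropy_strongly_convex by blast
qed

end
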